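(* Let $I=[a,b]$ be a closed bounded interval of reals, let $Y$ be a Banach space, and let $T\subset(a,b)$ be a set of Lebesgue measure zero. Let $f:I\to Y$ and $g:I\to\mathbb{R}$ be continuous functions. Assume that the right-sided Lipschitz derivative $L_+f(x)$ and the right-sided lower Dini derivative $D_+^l g(x)$ exist and are finite at every point $x\in(a,b)$. If $$L_+f(x)\le D_+^l g(x)\quad\text{for all }x\in(a,b)\setminus T,$$ then $$\|f(b)-f(a)\|\le g(b)-g(a).$$
   Context: For $x\in(a,b)$ the right-sided Lipschitz derivative of $f$ is $L_+f(x)=\limsup_{h>0,\,h\to0}\left\|\frac1h(f(x+h)-f(x))\right\|\in[0,\infty]$, and the right-sided lower Dini derivative of a real-valued $g$ is $D_+^lg(x)=\liminf_{h>0,\,h\to0}\frac1h(g(x+h)-g(x))\in[-\infty,\infty]$. *)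

theory Defs
  imports "HOL-Analysis.Analysis"
begin

text \<open>Both derivatives are right-sided limits of difference quotients, taken in the extended reals,
  so they always exist and their finiteness is a genuine hypothesis. At an interior point \<open>x\<close> of an
  interval \<open>{a..b}\<close> they only depend on the values of the function on \<open>{a..b}\<close>.\<close>

definition right_Lipschitz_deriv :: "(real \<Rightarrow> 'a::real_normed_vector) \<Rightarrow> real \<Rightarrow> ereal"
  where "right_Lipschitz_deriv f x =
    Limsup (at_right 0) (\<lambda>h. ereal (norm ((1 / h) *\<^sub>R (f (x + h) - f x))))"

definition right_lower_Dini_deriv :: "(real \<Rightarrow> real) \<Rightarrow> real \<Rightarrow> ereal"
  where "right_lower_Dini_deriv g x =
    Liminf (at_right 0) (\<lambda>h. ereal ((1 / h) * (g (x + h) - g x)))"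

end

theory Submission
  imports Defs
begin

text \<open>Enlarge \<open>g\<close> to \<open>G x = g x + e * x + w x\<close>, where \<open>w\<close> is a continuous nondecreasing
  function whose total increase is at most \<open>e\<close> and whose right derivative is \<open>\<infinity>\<close> at every point of
  the null set \<open>T\<close>. Finiteness of both derivatives then makes every increment of \<open>f\<close> over a short
  interval \<open>[x, x + h]\<close> at most that of \<open>G\<close>, also for \<open>x \<in> T\<close>. By a supremum argument this local
  comparison globalises, and \<open>e\<close> can be sent to \<open>0\<close>.\<close>

text \<open>The increment from \<open>x\<close> to \<open>y\<close> is the measure of
  \<open>U \<inter> {x<..y}\<close>. It thus lies between 0 and \<open>y - x\<close>, and the upper
  bound is attained when the interval lies in \<open>U\<close>.\<close>

lemma measure_Int_atMost_increment:
  fixes U :: "real set"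
  assumes "U \<in> lmeasurable" "x \<le> y"
  shows "measure lebesgue (U \<inter> {..x}) \<le> measure lebesgue (U \<inter> {..y})"
    and "measure lebesgue (U \<inter> {..y}) - measure lebesgue (U \<inter> {..x}) \<le> y - x"
    and "{x<..y} \<subseteq> U \<Longrightarrow> measure lebesgue (U \<inter> {..y}) - measure lebesgue (U \<inter> {..x}) = y - x"
proof -
  have fm: "U \<inter> {..z} \<in> lmeasurable" for z
    using assms(1) by (intro fmeasurable_Int_fmeasurable) auto
  have fm2: "U \<inter> {x<..y} \<in> lmeasurable"
    using assms(1) by (intro fmeasurable_Int_fmeasurable) auto
  have "U \<inter> {..y} = (U \<inter> {..x}) \<union> (U \<inter> {x<..y})"
    using assms(2) by auto
  then have eq: "measure lebesgue (U \<inter> {..y}) =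
      measure lebesgue (U \<inter> {..x}) + measure lebesgue (U \<inter> {x<..y})"
    using measure_Un2[OF fm[of x] fm2] by (simp add: Diff_triv disjoint_iff)
  have "{x<..y} \<in> lmeasurable"
    by (rule bounded_set_imp_lmeasurable) auto
  then have le: "measure lebesgue (U \<inter> {x<..y}) \<le> measure lebesgue {x<..y}"
    using fm2 by (intro measure_mono_fmeasurable) auto
  have len: "measure lebesgue {x<..y} = y - x"
    using assms(2) by simp
  show "measure lebesgue (U \<inter> {..x}) \<le> measure lebesgue (U \<inter> {..y})"
    using eq by simp
  show "measure lebesgue (U \<inter> {..y}) - measure lebesgue (U \<inter> {..x}) \<le> y - x"
    using eq le len by simp
  show "measure lebesgue (U \<inter> {..y}) - measure lebesgue (U \<inter> {..x}) = y - x"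
    if "{x<..y} \<subseteq> U"
    using eq len that by (simp add: Int_absorb1)
qed

text \<open>Cover \<open>T\<close> by open sets \<open>U n\<close> whose measures are bounded by a
  series with sum \<open>e\<close>, and let \<open>w x\<close> add up the measures of
  \<open>U n \<inter> {..x}\<close>. Just to the right of a point of \<open>T\<close>, each of the
  first \<open>N\<close> terms grows with slope 1, so \<open>w\<close> grows with slope at least
  \<open>N\<close>, for any \<open>N\<close>.\<close>

lemma null_set_continuous_mono_infinite_right_derivative:
  fixes T :: "real set" and e :: real
  assumes T: "T \<in> null_sets lebesgue" and e: "e > 0"
  obtains w :: "real \<Rightarrow> real" where
    "continuous_on UNIV w" "mono w" "\<And>x. 0 \<le> w x" "\<And>x. w x \<le> e"
    "\<And>x K. x \<in> T \<Longrightarrow> eventually (\<lambda>h. K * h \<le> w (x + h) - w x) (at_right 0)"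
proof -
  have "\<exists>U. open U \<and> T \<subseteq> U \<and> U \<in> lmeasurable \<and> measure lebesgue U < e * (1/2) ^ Suc n" for n
  proof -
    obtain U where U: "open U" "T \<subseteq> U" "U - T \<in> lmeasurable"
      "emeasure lebesgue (U - T) < ennreal (e * (1/2) ^ Suc n)"
      using sets_lebesgue_outer_open[OF null_setsD2[OF T], of "e * (1/2) ^ Suc n"] e by auto
    have "emeasure lebesgue U = emeasure lebesgue (U - T)"
      using emeasure_Diff_null_set[OF T, of U] U(1) by simp
    then have "emeasure lebesgue U < ennreal (e * (1/2) ^ Suc n)"
      using U(4) by simp
    moreover from this have "U \<in> lmeasurable"
      using U(1) less_trans[OF _ ennreal_less_top] by (intro fmeasurableI) auto
    ultimately show ?thesis
      using U(1,2) e by (auto simp: emeasure_eq_measure2 ennreal_less_iff)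
  qed
  then obtain U where U: "\<And>n. open (U n)" "\<And>n. T \<subseteq> U n" "\<And>n. U n \<in> lmeasurable"
    "\<And>n::nat. measure lebesgue (U n) < e * (1/2) ^ Suc n"
    by metis
  define m where "m n x = measure lebesgue (U n \<inter> {..x})" for n x
  define w where "w x = (\<Sum>n. m n x)" for x
  have m_le: "m n x \<le> e * (1/2) ^ Suc n" for n x
  proof -
    have "m n x \<le> measure lebesgue (U n)"
      unfolding m_def using U(3)[of n] by (intro measure_mono_fmeasurable) auto
    then show ?thesis using U(4)[of n] by simp
  qed
  have m_nn: "0 \<le> m n x" for n x
    by (simp add: m_def)
  have geo: "(\<lambda>n. e * (1/2) ^ Suc n) sums e"
    using sums_mult[OF power_half_series, of e] by simp
  have m_summable: "summable (\<lambda>n. m n x)" for x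
    by (rule summable_comparison_test'[OF sums_summable[OF geo], of 0])
      (use m_le m_nn in auto)
  have m_mono: "m n x \<le> m n y" if "x \<le> y" for n x y
    unfolding m_def by (rule measure_Int_atMost_increment(1)[OF U(3) that])
  have m_cont: "continuous_on UNIV (m n)" for n
  proof -
    have "\<bar>m n x - m n y\<bar> \<le> \<bar>x - y\<bar>" for x y
    proof (induction x y rule: linorder_wlog)
      case (le x y)
      then show ?case
        using measure_Int_atMost_increment(1,2)[OF U(3) le, of n] by (simp add: m_def)
    qed (simp add: abs_minus_commute)
    then have "1-lipschitz_on UNIV (m n)"
      by (intro lipschitz_onI) (auto simp: dist_real_def)
    then show ?thesis
      by (rule lipschitz_on_continuous_on)
  qed
  show thesis
  proof
    \<comment> \<open>The bounds in \<open>m_le\<close> do not depend on \<open>x\<close>, so the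
      series converges uniformly and the continuity of its terms passes to \<open>w\<close>.\<close>
    have ul: "uniform_limit UNIV (\<lambda>N x. \<Sum>n<N. m n x) w sequentially"
      unfolding w_def
      by (rule Weierstrass_m_test[OF _ sums_summable[OF geo]]) (use m_le m_nn in auto)
    show "continuous_on UNIV w"
      by (rule uniform_limit_theorem[OF _ ul])
        (auto intro!: always_eventually continuous_on_sum m_cont)
    show "mono w"
      unfolding w_def by (intro monoI suminf_le m_summable m_mono)
    show "0 \<le> w x" for x
      unfolding w_def by (intro suminf_nonneg m_summable m_nn)
    show "w x \<le> e" for x
      using suminf_le[OF m_le m_summable sums_summable[OF geo]] sums_unique[OF geo]
      by (simp add: w_def)
    show "eventually (\<lambda>h. K * h \<le> w (x + h) - w x) (at_right 0)" if "x \<in> T" for x K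
    proof -
      obtain N :: nat where N: "K \<le> real N"
        using real_arch_simple by blast
      \<comment> \<open>Only finitely many \<open>U n\<close> are intersected, so that a whole ball
        around \<open>x\<close> fits into all of them.\<close>
      have "open (\<Inter>n<N. U n)" "x \<in> (\<Inter>n<N. U n)"
        using U that by auto
      then obtain d where d: "d > 0" "ball x d \<subseteq> (\<Inter>n<N. U n)"
        using open_contains_ball by blast
      have "K * h \<le> w (x + h) - w x" if h: "0 < h" "h < d" for h
      proof -
        have "m n (x + h) - m n x = h" if "n < N" for n
        proof -
          have "{x<..x+h} \<subseteq> ball x d"
            using h by (auto simp: dist_real_def)
          then have "{x<..x+h} \<subseteq> U n"
            using d that by auto
          from measure_Int_atMost_increment(3)[OF U(3) _ this] h show ?thesis
            by (simp add: m_def)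
        qed
        then have "real N * h = (\<Sum>n<N. m n (x + h) - m n x)"
          by simp
        \<comment> \<open>The terms from \<open>N\<close> on are nonnegative, because each
          \<open>m n\<close> is nondecreasing.\<close>
        also have "\<dots> \<le> (\<Sum>n. m n (x + h) - m n x)"
          using h by (intro sum_le_suminf summable_diff m_summable) (auto intro: m_mono)
        also have "\<dots> = w (x + h) - w x"
          unfolding w_def by (intro suminf_diff[symmetric] m_summable)
        finally show ?thesis
          using N h by (meson mult_right_mono less_imp_le order_trans)
      qed
      then show ?thesis
        using d(1) by (auto simp: eventually_at_right_field)
    qed
  qed
qed

lemma norm_diff_le_if_eventually_right:
  fixes f :: "real \<Rightarrow> 'a::real_normed_vector" and g :: "real \<Rightarrow> real"
  assumes "c \<le> b" and f: "continuous_on {c..b} f" and g: "continuous_on {c..b} g"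
    and local: "\<And>x. x \<in> {c..<b} \<Longrightarrow>
      eventually (\<lambda>h. norm (f (x + h) - f x) \<le> g (x + h) - g x) (at_right 0)"
  shows "norm (f b - f c) \<le> g b - g c"
proof -
  \<comment> \<open>Membership compares \<open>x\<close> with \<open>c\<close> only and says nothing
    about the points between. By continuity \<open>S\<close> is closed, so it contains its supremum;
    below \<open>b\<close>, the local estimate and the triangle inequality would push it further
    right.\<close>
  define S where "S = {x \<in> {c..b}. norm (f x - f c) \<le> g x - g c}"
  have "closed S"
    unfolding S_def by (intro continuous_on_closed_Collect_le continuous_intros f g closed_atLeastAtMost)
  moreover have "c \<in> S" "bdd_above S"
    using assms(1) by (auto simp: S_def intro: bdd_aboveI)
  ultimately have s: "Sup S \<in> S"
    by (intro closed_contains_Sup) auto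
  define s where "s = Sup S"
  have "s = b"
  proof (rule ccontr)
    assume "s \<noteq> b"
    then have sb: "s \<in> {c..<b}"
      using s by (auto simp: S_def s_def)
    have "eventually (\<lambda>h. h < b - s) (at_right 0)"
      using sb by (auto simp: eventually_at_right_field intro: exI[of _ "b - s"])
    then have "eventually (\<lambda>h. h > 0 \<and> h < b - s \<and> norm (f (s + h) - f s) \<le> g (s + h) - g s) (at_right 0)"
      using local[OF sb] eventually_at_right_less by eventually_elim auto
    then obtain h where h: "h > 0" "h < b - s" "norm (f (s + h) - f s) \<le> g (s + h) - g s"
      using eventually_happens'[OF trivial_limit_at_right_real] by blast
    have "norm (f (s + h) - f c) \<le> norm (f (s + h) - f s) + norm (f s - f c)"
      using norm_triangle_ineq[of "f (s + h) - f s" "f s - f c"] by simp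
    then have "s + h \<in> S"
      using h s sb by (auto simp: S_def s_def)
    then have "s + h \<le> s"
      unfolding s_def using \<open>bdd_above S\<close> by (rule cSup_upper)
    then show False using h by simp
  qed
  then show ?thesis
    using s by (auto simp: S_def s_def)
qed

lemma eventually_norm_diff_less_right_Lipschitz_deriv:
  assumes "right_Lipschitz_deriv f x < ereal l"
  shows "eventually (\<lambda>h. norm (f (x + h) - f x) < l * h) (at_right 0)"
proof -
  have "eventually (\<lambda>h. ereal (norm ((1 / h) *\<^sub>R (f (x + h) - f x))) < ereal l) (at_right 0)"
    using assms unfolding right_Lipschitz_deriv_def by (rule Limsup_lessD)
  then show ?thesis
    using eventually_at_right_less[of 0]
    by eventually_elim (simp add: pos_divide_less_eq)
qed

lemma eventually_diff_greater_right_lower_Dini_deriv: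
  assumes "ereal d < right_lower_Dini_deriv g x"
  shows "eventually (\<lambda>h. d * h < g (x + h) - g x) (at_right 0)"
proof -
  have "eventually (\<lambda>h. ereal d < ereal ((1 / h) * (g (x + h) - g x))) (at_right 0)"
    using assms unfolding right_lower_Dini_deriv_def by (rule less_LiminfD)
  then show ?thesis
    using eventually_at_right_less[of 0]
    by eventually_elim (simp add: field_simps)
qed

theorem theorem6p1:
  fixes f :: "real \<Rightarrow> 'a::banach" and g :: "real \<Rightarrow> real"
    and a b :: real and T :: "real set"
  assumes "a \<le> b"
    and "T \<subseteq> {a<..<b}" and "T \<in> null_sets lebesgue"
    and "continuous_on {a..b} f" and "continuous_on {a..b} g"
    and "\<And>x. x \<in> {a<..<b} \<Longrightarrow> \<bar>right_Lipschitz_deriv f x\<bar> \<noteq> \<infinity>"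
    and "\<And>x. x \<in> {a<..<b} \<Longrightarrow> \<bar>right_lower_Dini_deriv g x\<bar> \<noteq> \<infinity>"
    and "\<And>x. x \<in> {a<..<b} - T \<Longrightarrow> right_Lipschitz_deriv f x \<le> right_lower_Dini_deriv g x"
  shows "norm (f b - f a) \<le> g b - g a"
proof (cases "a = b")
  case False
  then have ab: "a < b" using assms(1) by simp
  \<comment> \<open>The comparison starts at \<open>c > a\<close> because the local estimate is
    needed at the left end itself, while the derivatives are controlled only inside the open
    interval. Continuity at \<open>a\<close> closes the gap at the end.\<close>
  have *: "norm (f b - f c) \<le> g b - g c + e * (b - c + 1)"
    if c: "c \<in> {a<..b}" and e: "e > 0" for c e
  proof -
    obtain w where w: "continuous_on UNIV w" "mono w" "\<And>x. 0 \<le> w x" "\<And>x. w x \<le> e"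
      "\<And>x K. x \<in> T \<Longrightarrow> eventually (\<lambda>h. K * h \<le> w (x + h) - w x) (at_right 0)"
      using null_set_continuous_mono_infinite_right_derivative[OF assms(3) e] by blast
    define G where "G x = g x + e * x + w x" for x
    have "norm (f b - f c) \<le> G b - G c"
    proof (rule norm_diff_le_if_eventually_right)
      show "continuous_on {c..b} f"
        using c by (intro continuous_on_subset[OF assms(4)]) auto
      show "continuous_on {c..b} G"
        unfolding G_def using c
        by (intro continuous_intros continuous_on_subset[OF assms(5)] continuous_on_subset[OF w(1)]) auto
      fix x assume "x \<in> {c..<b}"
      then have x: "x \<in> {a<..<b}" using c by auto
      obtain l where l: "right_Lipschitz_deriv f x = ereal l"
        using assms(6)[OF x] by auto
      obtain d where d: "right_lower_Dini_deriv g x = ereal d"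
        using assms(7)[OF x] by auto
      \<comment> \<open>The excess \<open>l - d\<close> is a real number since both derivatives are
        finite. Off \<open>T\<close> it is at most 0, so monotonicity of \<open>w\<close> suffices;
        on \<open>T\<close> the infinite right derivative of \<open>w\<close> absorbs it.\<close>
      have "eventually (\<lambda>h. (l - d) * h \<le> w (x + h) - w x) (at_right 0)"
      proof (cases "x \<in> T")
        case False
        then have "l \<le> d"
          using assms(8)[of x] x l d by simp
        then have "(l - d) * h \<le> w (x + h) - w x" if "h > 0" for h
          using monoD[OF w(2), of x "x + h"] that mult_nonpos_nonneg[of "l - d" h] by simp
        then show ?thesis
          by (auto intro: eventually_mono[OF eventually_at_right_less])
      qed (rule w(5))
      \<comment> \<open>The slope \<open>e\<close> of the linear term in \<open>G\<close> is split
        in halves, one for each derivative, to get strict inequalities: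
        \<open>(l + e/2) * h = (d - e/2) * h + (l - d) * h + e * h\<close>.\<close>
      moreover have "eventually (\<lambda>h. norm (f (x + h) - f x) < (l + e/2) * h) (at_right 0)"
        using e l by (intro eventually_norm_diff_less_right_Lipschitz_deriv) simp
      moreover have "eventually (\<lambda>h. (d - e/2) * h < g (x + h) - g x) (at_right 0)"
        using e d by (intro eventually_diff_greater_right_lower_Dini_deriv) simp
      ultimately show "eventually (\<lambda>h. norm (f (x + h) - f x) \<le> G (x + h) - G x) (at_right 0)"
        by eventually_elim (simp add: G_def algebra_simps)
    qed (use c in auto)
    \<comment> \<open>The linear term costs \<open>e * (b - c)\<close>, and \<open>w\<close> rises
      by at most \<open>e\<close>.\<close>
    also have "\<dots> \<le> g b - g c + e * (b - c + 1)"
      using w(3)[of c] w(4)[of b] by (simp add: G_def algebra_simps)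
    finally show ?thesis .
  qed
  have **: "norm (f b - f c) \<le> g b - g c" if c: "c \<in> {a<..b}" for c
  proof (rule tendsto_lowerbound)
    show "((\<lambda>e. g b - g c + e * (b - c + 1)) \<longlongrightarrow> g b - g c) (at_right 0)"
      by (auto intro!: tendsto_eq_intros)
    show "eventually (\<lambda>e. norm (f b - f c) \<le> g b - g c + e * (b - c + 1)) (at_right 0)"
      using *[OF c] by (auto intro: eventually_mono[OF eventually_at_right_less])
  qed simp
  have lim: "(f \<longlongrightarrow> f a) (at_right a)" "(g \<longlongrightarrow> g a) (at_right a)"
    using continuous_on_Icc_at_rightD assms(4,5) ab by blast+
  show ?thesis
  proof (rule tendsto_le)
    show "((\<lambda>c. g b - g c) \<longlongrightarrow> g b - g a) (at_right a)"
      "((\<lambda>c. norm (f b - f c)) \<longlongrightarrow> norm (f b - f a)) (at_right a)"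
      by (intro tendsto_intros lim)+
    show "eventually (\<lambda>c. norm (f b - f c) \<le> g b - g c) (at_right a)"
      using ** eventually_at_right_real[OF ab] by (auto elim!: eventually_mono)
  qed simp
qed simp

end
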